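(* There is an absolute constant $c>0$ such that for all sufficiently large $n$ and all $1\le k\le n$ the following hold in the strongly adaptive adversary model on $n$ nodes. (a) For every initial token distribution in which each of the $k$ tokens is held by exactly one node, every randomized token-forwarding algorithm (centralized or distributed) for $k$-gossip needs at least $c\left(\frac{nk}{\log n}+n\right)$ rounds. (b) If the initial token distribution is random, with each of the $n$ nodes receiving each of the $k$ tokens independently with probability $3/4$, then with high probability over the initial token distribution every randomized token-forwarding algorithm (centralized or distributed) for $k$-gossip needs at least $c\left(\frac{nk}{\log n}+n\right)$ rounds.
   Context: $k$-gossip: there are $n$ nodes and $k$ distinct tokens; initially each node holds some subset of the tokens, and the goal is that every node holds all $k$ tokens. Communication proceeds in synchronous rounds. A node that holds a token keeps it and can copy and forward it. A token-forwarding algorithm does not manipulate tokens in any way other than storing, copying and forwarding them; in particular a node can only send a token that it held at the start of the round. Strongly adaptive adversary model: in each round, each node first chooses one token (among those it holds) to broadcast to all its neighbors, without knowing who the neighbors are; the choice made by each node may depend arbitrarily (and randomly) on the tokens held by that node and by the other nodes, so both centralized and distributed algorithms are allowed. Then the adversary, knowing the tokens chosen by all nodes, chooses an arbitrary connected communication graph on the $n$ nodes for that round, and each node receives the tokens broadcast by its neighbors in that graph. An algorithm "needs at least $R$ rounds" (from a given initial token distribution) means that the adversary has a strategy under which $k$-gossip is not completed in fewer than $R$ rounds, whatever random choices the algorithm makes. "With high probability" means with probability at least $1-n^{-a}$ for some absolute constant $a>0$. *)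

theory Defs
  imports "HOL-Probability.Probability" "Graph_Theory.Digraph_Component"
begin

text \<open>
  The nodes are the numbers below \<open>n\<close>, the tokens are the numbers below \<open>k\<close>.
  Values of a \<open>holdings\<close> or \<open>sends\<close> function at numbers that are not nodes are irrelevant:
  communication graphs only have the nodes as vertices.
\<close>

type_synonym holdings = "nat \<Rightarrow> nat set"
type_synonym sends = "nat \<Rightarrow> nat option"  \<comment> \<open>\<open>None\<close>: the node broadcasts nothing\<close>
type_synonym comm = "nat pair_pre_digraph"
type_synonym history = "(sends \<times> comm) list"  \<comment> \<open>the most recent round comes first\<close>

text \<open>
  An undirected simple graph is a finite, loop-free digraph with a symmetric arc relation.
\<close>

definition comm_graph :: "nat \<Rightarrow> comm \<Rightarrow> bool" where
  "comm_graph n G \<longleftrightarrow>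
     pair_graph G \<and> pverts G = {..<n} \<and> Digraph_Component.connected (with_proj G)"

primrec held :: "holdings \<Rightarrow> history \<Rightarrow> holdings" where
  "held I [] = I"
| "held I (r # h) =
     (\<lambda>v. held I h v \<union> {i. \<exists>u. (u, v) \<in> parcs (snd r) \<and> fst r u = Some i})"

definition gossip_complete :: "nat \<Rightarrow> nat \<Rightarrow> holdings \<Rightarrow> bool" where
  "gossip_complete n k K \<longleftrightarrow> (\<forall>v<n. {..<k} \<subseteq> K v)"

definition legal_sends :: "nat \<Rightarrow> holdings \<Rightarrow> sends \<Rightarrow> bool" where
  "legal_sends n K s \<longleftrightarrow>
     (\<forall>v<n. case s v of None \<Rightarrow> K v = {} | Some i \<Rightarrow> i \<in> K v)"

text \<open>
  A randomized algorithm is given by the joint distribution of the choices of all nodes in the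
  next round, conditioned on the initial token distribution and on everything that happened in
  the previous rounds. Since the choices may be arbitrarily correlated and may depend on the
  situation of all nodes, this covers centralized as well as distributed algorithms.
\<close>

type_synonym algorithm = "holdings \<Rightarrow> history \<Rightarrow> sends pmf"

definition token_forwarding :: "nat \<Rightarrow> algorithm \<Rightarrow> bool" where
  "token_forwarding n A \<longleftrightarrow>
     (\<forall>I h. \<forall>s\<in>set_pmf (A I h). legal_sends n (held I h) s)"

text \<open>
  The adversary knows the past and the choices made by all nodes for the current round, but not
  the future random choices of the algorithm.
\<close>

type_synonym adversary = "history \<Rightarrow> sends \<Rightarrow> comm"

inductive execution :: "algorithm \<Rightarrow> adversary \<Rightarrow> holdings \<Rightarrow> history \<Rightarrow> bool"
  for A :: algorithm and S :: adversary and I :: holdings where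
  start: "execution A S I []"
| round: "execution A S I h \<Longrightarrow> s \<in> set_pmf (A I h) \<Longrightarrow> execution A S I ((s, S h s) # h)"

definition needs_rounds :: "nat \<Rightarrow> nat \<Rightarrow> algorithm \<Rightarrow> holdings \<Rightarrow> real \<Rightarrow> bool" where
  "needs_rounds n k A I R \<longleftrightarrow>
     (\<exists>S. (\<forall>h s. comm_graph n (S h s)) \<and>
          (\<forall>h. execution A S I h \<and> real (length h) < R \<longrightarrow> \<not> gossip_complete n k (held I h)))"

definition every_algorithm_needs_rounds :: "nat \<Rightarrow> nat \<Rightarrow> holdings \<Rightarrow> real \<Rightarrow> bool" where
  "every_algorithm_needs_rounds n k I R \<longleftrightarrow>
     (\<forall>A. token_forwarding n A \<longrightarrow> needs_rounds n k A I R)"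

definition single_holder :: "nat \<Rightarrow> nat \<Rightarrow> holdings \<Rightarrow> bool" where
  "single_holder n k I \<longleftrightarrow>
     (\<forall>v<n. I v \<subseteq> {..<k}) \<and> (\<forall>i<k. \<exists>!v. v < n \<and> i \<in> I v)"

definition random_distribution :: "nat \<Rightarrow> nat \<Rightarrow> real \<Rightarrow> holdings pmf" where
  "random_distribution n k p =
     map_pmf (\<lambda>f v. {i. f (v, i)}) (Pi_pmf ({..<n} \<times> {..<k}) False (\<lambda>_. bernoulli_pmf p))"

end

theory Submission
  imports Defs "HOL-Real_Asymp.Real_Asymp"
begin

text \<open>
  Fix auxiliary sets \<open>K' v\<close> and count the pairs \<open>(v, i)\<close> such that \<open>v\<close> lacks token \<open>i\<close> and
  \<open>i \<notin> K' v\<close>. An edge is free in a round if the two tokens broadcast by its ends do not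
  decrease this count. The adversary uses all free edges and joins a maximal set of pairwise
  non-free nodes by a star, so that a round decreases the count by at most twice the size of that
  set. Such a set yields a half-empty configuration for \<open>K'\<close>: nodes with distinct tokens such that
  for any two of them at least one of the two tokens is missing from \<open>K'\<close> at the other node. For
  \<open>K'\<close> random with density \<open>3/4\<close>, a union bound excludes such configurations of a size
  of order \<open>ln n\<close>, while a constant fraction of all pairs is missing from \<open>K'\<close>. In (a) such
  a \<open>K'\<close> exists by the probabilistic method; in (b) the initial distribution itself
  serves as \<open>K'\<close>. The summand \<open>n\<close> of the bound comes from counting a single token only.
\<close>

subsection \<open>The adversary\<close>

definition missing :: "nat \<Rightarrow> nat set \<Rightarrow> holdings \<Rightarrow> (nat \<times> nat) set" where
  "missing n T K = {(v, i). v < n \<and> i \<in> T \<and> i \<notin> K v}"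

text \<open>A pair \<open>(v, i)\<close> in \<open>C\<close> stands for a node \<open>v\<close> that broadcasts token \<open>i\<close>.\<close>

definition half_empty_free :: "nat \<Rightarrow> nat set \<Rightarrow> nat \<Rightarrow> holdings \<Rightarrow> bool" where
  "half_empty_free n T l K \<longleftrightarrow>
     (\<forall>C. C \<subseteq> {..<n} \<times> T \<and> card C = l \<and> inj_on fst C \<and> inj_on snd C \<longrightarrow>
        (\<exists>x\<in>C. \<exists>y\<in>C. x \<noteq> y \<and> snd x \<in> K (fst y) \<and> snd y \<in> K (fst x)))"

section \<open>Connected graphs with few non-free edges\<close>

lemma comm_graphI:
  assumes "pverts G = {..<n}" "parcs G \<subseteq> {..<n} \<times> {..<n}" "n > 0"
    and irrefl: "\<And>u. (u, u) \<notin> parcs G"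
    and sym: "\<And>u v. (u, v) \<in> parcs G \<Longrightarrow> (v, u) \<in> parcs G"
    and reach: "\<And>v. v < n \<Longrightarrow> (v, d) \<in> (parcs G)\<^sup>*"
  shows "comm_graph n G"
proof -
  have fin: "finite (parcs G)"
    using assms(2) by (rule finite_subset) simp
  interpret pair_graph G
    using assms(1,2) fin irrefl sym
    by unfold_locales (auto 0 3 simp: symmetric_def sym_def prod_eq_iff)
  have "u \<rightarrow>\<^sup>*\<^bsub>with_proj G\<^esub> v" if "u < n" "v < n" for u v
  proof -
    \<comment> \<open>Symmetry reverses the path from \<open>v\<close> to the hub \<open>d\<close>,
      so any two nodes are connected through \<open>d\<close>.\<close>
    have "(parcs G)\<inverse> = parcs G"
      using sym by auto
    then have "(d, v) \<in> (parcs G)\<^sup>*"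
      using reach[OF that(2)] by (metis rtrancl_converseI)
    then have "(u, v) \<in> (parcs G)\<^sup>*"
      using reach[OF that(1)] by simp
    then show ?thesis
      using that assms(1) by (induction rule: rtrancl_induct)
        (auto intro: reachable_adj_trans in_arcsD2 in_arcsD1)
  qed
  then have "Digraph_Component.connected (with_proj G)"
    using assms(1,3) unfolding Digraph_Component.connected_def strongly_connected_def
    by (auto intro: reachable_mk_symmetricI)
  then show ?thesis
    unfolding comm_graph_def using assms(1) pair_graph_axioms by blast
qed

text \<open>A largest independent set \<open>D\<close> of the relation \<open>F\<close> is
  dominating: a node outside \<open>D\<close> without an \<open>F\<close>-neighbour in
  \<open>D\<close> could be added. Hence the \<open>F\<close>-edges together with a star on
  \<open>D\<close> are connected, and only the star, with at most \<open>card D\<close> arcs in each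
  direction, can violate \<open>F\<close>.\<close>

lemma comm_graph_few_exceptions:
  fixes F :: "nat \<Rightarrow> nat \<Rightarrow> bool"
  assumes n: "n > 0" and sym: "\<And>u v. F u v \<Longrightarrow> F v u"
    and indep: "\<And>D. D \<subseteq> {..<n} \<Longrightarrow> (\<And>u v. u \<in> D \<Longrightarrow> v \<in> D \<Longrightarrow> u \<noteq> v \<Longrightarrow> \<not> F u v) \<Longrightarrow> card D \<le> l"
  obtains G where "comm_graph n G" "card {(u, v) \<in> parcs G. \<not> F u v} \<le> 2 * l"
proof -
  define ind where "ind D \<longleftrightarrow> D \<subseteq> {..<n} \<and> (\<forall>u\<in>D. \<forall>v\<in>D. u \<noteq> v \<longrightarrow> \<not> F u v)" for D
  \<comment> \<open>This independent set makes a largest one exist and shows that it is nonempty, so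
    that the star has a centre.\<close>
  have "ind {0}" using n by (auto simp: ind_def)
  moreover have "card D < Suc l" if "ind D" for D
    using that indep[of D] unfolding ind_def by (simp add: le_imp_less_Suc)
  ultimately obtain D where D: "ind D" and max: "\<And>D'. ind D' \<Longrightarrow> card D' \<le> card D"
    using ex_has_greatest_nat[of ind "{0}" card "Suc l"] by auto
  have finD: "finite D" using D finite_subset[of D "{..<n}"] by (auto simp: ind_def)
  have "D \<noteq> {}" using max[OF \<open>ind {0}\<close>] by auto
  then obtain d where d: "d \<in> D" by blast
  have dom: "\<exists>w\<in>D. F v w" if v: "v < n" "v \<notin> D" for v
  proof (rule ccontr)
    assume "\<not> ?thesis"
    then have "ind (insert v D)"
      using D v sym unfolding ind_def by blast
    from max[OF this] show False
      using v finD by simp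
  qed
  define G where "G = \<lparr>pverts = {..<n}, parcs = {(u, v). u < n \<and> v < n \<and> u \<noteq> v \<and>
    (F u v \<or> u = d \<and> v \<in> D \<or> v = d \<and> u \<in> D)}\<rparr>"
  have lt: "v < n" if "v \<in> D" for v using D that by (auto simp: ind_def)
  have toD: "(v, d) \<in> (parcs G)\<^sup>*" if "v \<in> D" for v
    using that d lt by (cases "v = d") (auto simp: G_def)
  have "comm_graph n G"
  proof (rule comm_graphI[where d = d])
    show "(v, d) \<in> (parcs G)\<^sup>*" if v: "v < n" for v
    proof (cases "v \<in> D")
      case False
      then obtain w where w: "w \<in> D" "F v w" using dom v by blast
      then have "(v, w) \<in> parcs G" using v False lt by (auto simp: G_def)
      then show ?thesis using toD[OF w(1)] by (rule converse_rtrancl_into_rtrancl)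
    qed (rule toD)
  qed (use n sym in \<open>auto simp: G_def\<close>)
  moreover have "card {(u, v) \<in> parcs G. \<not> F u v} \<le> 2 * l"
  proof -
    have "{(u, v) \<in> parcs G. \<not> F u v} \<subseteq> Pair d ` D \<union> (\<lambda>u. (u, d)) ` D"
      by (auto simp: G_def)
    then have "card {(u, v) \<in> parcs G. \<not> F u v} \<le> card (Pair d ` D \<union> (\<lambda>u. (u, d)) ` D)"
      using finD by (intro card_mono) auto
    also have "\<dots> \<le> card D + card D"
      by (intro order.trans[OF card_Un_le] add_mono card_image_le finD)
    also have "\<dots> \<le> 2 * l"
      using indep[of D] D unfolding ind_def by simp
    finally show ?thesis .
  qed
  ultimately show thesis by (rule that)
qed

section \<open>Progress in a round and in an execution\<close>

lemma finite_missing: "finite T \<Longrightarrow> finite (missing n T K)"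
  by (rule finite_subset[of _ "{..<n} \<times> T"]) (auto simp: missing_def)

text \<open>With \<open>F\<close> as the free edges, a set of more than \<open>l\<close> pairwise
  non-free nodes would contain a half-empty configuration of size \<open>l\<close>. So some
  connected graph has at most \<open>2 * l\<close> non-free arcs, and each pair that stops being
  missing is paid for by one of them.\<close>

lemma round_progress:
  assumes n: "n > 0" and T: "finite T" and legal: "legal_sends n K s"
    and free: "half_empty_free n T l K'"
  obtains G where "comm_graph n G"
    "card (missing n T (\<lambda>v. K v \<union> K' v)) \<le>
     card (missing n T (\<lambda>v. held K [(s, G)] v \<union> K' v)) + 2 * l"
proof -
  define useful where "useful u v \<longleftrightarrow> (\<exists>i\<in>T. s u = Some i \<and> i \<notin> K v \<union> K' v)" for u v
  define F where "F u v \<longleftrightarrow> \<not> useful u v \<and> \<not> useful v u" for u v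
  have indep: "card D \<le> l" if D: "D \<subseteq> {..<n}"
    and nF: "\<And>u v. u \<in> D \<Longrightarrow> v \<in> D \<Longrightarrow> u \<noteq> v \<Longrightarrow> \<not> F u v" for D
  proof (rule ccontr)
    assume "\<not> card D \<le> l"
    define C where "C = {(v, i). v \<in> D \<and> s v = Some i \<and> i \<in> T}"
    have finD: "finite D" using D by (rule finite_subset) simp
    have injf: "inj_on fst C" by (auto simp: inj_on_def C_def)
    have finC: "finite C"
      by (rule finite_subset[of _ "D \<times> T"]) (use finD T in \<open>auto simp: C_def\<close>)
    have holds: "i \<in> K v" if "v \<in> D" "s v = Some i" for v i
      using legal that D unfolding legal_sends_def by (force split: option.splits)
    \<comment> \<open>Nodes that send the same token both hold it already, by legality, so the edge
      between them is free.\<close>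
    have injs: "inj_on snd C"
    proof (rule inj_onI)
      fix x y assume "x \<in> C" "y \<in> C" "snd x = snd y"
      then obtain u v i where uv: "x = (u, i)" "y = (v, i)" "u \<in> D" "v \<in> D"
          "s u = Some i" "s v = Some i"
        by (auto simp: C_def)
      then have "F u v" using holds unfolding F_def useful_def by auto
      then show "x = y" using nF[of u v] uv by auto
    qed
    \<comment> \<open>Two nodes that send no token of \<open>T\<close> are always joined by a free edge.\<close>
    have "card (D - fst ` C) \<le> Suc 0"
    proof (subst card_le_Suc0_iff_eq)
      show "\<forall>u\<in>D - fst ` C. \<forall>v\<in>D - fst ` C. u = v"
      proof (intro ballI, rule ccontr)
        fix u v assume u: "u \<in> D - fst ` C" and v: "v \<in> D - fst ` C" and "u \<noteq> v"
        have "\<not> (s w = Some i \<and> i \<in> T)" if "w \<in> D - fst ` C" for w i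
          using that by (force simp: C_def)
        then have "F u v" using u v unfolding F_def useful_def by blast
        then show False using nF[of u v] u v \<open>u \<noteq> v\<close> by blast
      qed
    qed (use finD in auto)
    moreover have "fst ` C \<subseteq> D" by (auto simp: C_def)
    moreover have "card (fst ` C) = card C" using injf by (rule card_image)
    \<comment> \<open>\<open>D\<close> has at least \<open>l + 1\<close> nodes and at most one of
      them sends no token of \<open>T\<close>. This one node is the reason for the bound
      \<open>l\<close> on \<open>card D\<close> rather than \<open>l - 1\<close>.\<close>
    ultimately have "l \<le> card C"
      using \<open>\<not> card D \<le> l\<close> finD finC card_Diff_subset[of "fst ` C" D] by auto
    then obtain C' where C': "C' \<subseteq> C" "card C' = l"
      by (rule obtain_subset_with_card_n)
    moreover have "C' \<subseteq> {..<n} \<times> T" using C' D by (auto simp: C_def)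
    moreover have "inj_on fst C'" "inj_on snd C'"
      using C' injf injs inj_on_subset by blast+
    ultimately obtain x y where "x \<in> C'" "y \<in> C'" and
      xy: "x \<noteq> y" "snd x \<in> K' (fst y)" "snd y \<in> K' (fst x)"
      using free unfolding half_empty_free_def by blast
    then have "x \<in> C" "y \<in> C" using C' by auto
    then have "fst x \<in> D" "fst y \<in> D" "s (fst x) = Some (snd x)" "s (fst y) = Some (snd y)"
      by (auto simp: C_def)
    moreover have "fst x \<noteq> fst y"
      using inj_onD[OF injf] \<open>x \<in> C\<close> \<open>y \<in> C\<close> xy(1) by blast
    \<comment> \<open>Each of the two tokens lies in \<open>K'\<close> at the opposite node, so
      neither transmission changes the count.\<close>
    moreover have "F (fst x) (fst y)"
      using calculation xy unfolding F_def useful_def by auto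
    ultimately show False using nF by blast
  qed
  obtain G where G: "comm_graph n G" and few: "card {(u, v) \<in> parcs G. \<not> F u v} \<le> 2 * l"
    by (rule comm_graph_few_exceptions[OF n _ indep, of F]) (auto simp: F_def)
  interpret pair_graph G using G by (simp add: comm_graph_def)
  let ?old = "missing n T (\<lambda>v. K v \<union> K' v)"
  let ?new = "missing n T (\<lambda>v. held K [(s, G)] v \<union> K' v)"
  let ?X = "{(u, v) \<in> parcs G. \<not> F u v}"
  have finX: "finite ?X"
    by (rule finite_subset[OF _ pair_finite_arcs]) auto
  \<comment> \<open>A pair that is no longer missing is charged to an arc that delivered it. The arc
    is non-free and determines the pair.\<close>
  have "?old \<subseteq> ?new \<union> (\<lambda>(u, v). (v, the (s u))) ` ?X"
  proof
    fix x assume x: "x \<in> ?old"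
    obtain v i where vi: "x = (v, i)" by (cases x)
    show "x \<in> ?new \<union> (\<lambda>(u, v). (v, the (s u))) ` ?X"
    proof (cases "x \<in> ?new")
      case False
      then obtain u where "(u, v) \<in> parcs G" "s u = Some i"
        using x vi by (auto simp: missing_def)
      moreover from this have "\<not> F u v"
        using x vi by (auto simp: missing_def F_def useful_def)
      ultimately show ?thesis using vi by force
    qed simp
  qed
  then have "card ?old \<le> card (?new \<union> (\<lambda>(u, v). (v, the (s u))) ` ?X)"
    using finX T by (intro card_mono) (auto intro: finite_missing)
  also have "\<dots> \<le> card ?new + card ?X"
    by (intro order.trans[OF card_Un_le] add_mono card_image_le finX order.refl)
  finally show thesis using that G few by fastforce
qed

text \<open>Completion leaves nothing missing, while each round removes at most \<open>2 * l\<close>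
  pairs. The token set \<open>T\<close> is a parameter so that one argument serves both for counting
  all tokens and for counting a single one.\<close>

lemma every_algorithm_needs_rounds_missing:
  assumes n: "n > 0" and T: "T \<subseteq> {..<k}" and free: "half_empty_free n T l K'"
    and R: "R * (2 * real l) \<le> real (card (missing n T (\<lambda>v. I v \<union> K' v)))"
  shows "every_algorithm_needs_rounds n k I R"
  unfolding every_algorithm_needs_rounds_def
proof (intro allI impI)
  fix A assume A: "token_forwarding n A"
  \<comment> \<open>The empty set is a configuration of size \<open>0\<close>.\<close>
  have l: "l > 0" using free by (cases l) (auto simp: half_empty_free_def)
  have finT: "finite T" using T by (rule finite_subset) simp
  define M where "M h = card (missing n T (\<lambda>v. held I h v \<union> K' v))" for h
  have "\<exists>G. comm_graph n G \<and> (legal_sends n (held I h) s \<longrightarrow> M h \<le> M ((s, G) # h) + 2 * l)"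
    for h s
  proof (cases "legal_sends n (held I h) s")
    case True
    obtain G where "comm_graph n G" "M h \<le>
        card (missing n T (\<lambda>v. held (held I h) [(s, G)] v \<union> K' v)) + 2 * l"
      unfolding M_def by (rule round_progress[OF n finT True free])
    then show ?thesis by (auto simp: M_def)
  next
    case False
    \<comment> \<open>A strategy must return a connected graph even for illegal sends. If all edges
      are free, independent sets have at most one node.\<close>
    have "\<exists>G. comm_graph n G"
      by (rule comm_graph_few_exceptions[OF n, of "\<lambda>_ _. True" 1])
        (auto simp: card_le_Suc0_iff_eq[OF finite_subset[OF _ finite_lessThan]])
    then show ?thesis using False by blast
  qed
  then obtain S where S: "\<And>h s. comm_graph n (S h s)"
    "\<And>h s. legal_sends n (held I h) s \<Longrightarrow> M h \<le> M ((s, S h s) # h) + 2 * l"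
    by metis
  have progress: "M [] \<le> M h + 2 * l * length h" if "execution A S I h" for h
    using that
  proof induction
    case (round h s)
    then have "legal_sends n (held I h) s"
      using A by (auto simp: token_forwarding_def)
    from S(2)[OF this] round.IH show ?case by simp
  qed simp
  show "needs_rounds n k A I R"
    unfolding needs_rounds_def
  proof (intro exI[of _ S] conjI allI impI S(1) notI)
    fix h assume h: "execution A S I h \<and> real (length h) < R"
      and complete: "gossip_complete n k (held I h)"
    have "M h = 0"
      using complete T by (auto simp: M_def missing_def gossip_complete_def card_eq_0_iff)
    then have "M [] \<le> length h * (2 * l)"
      using progress[of h] h by (simp add: ac_simps)
    then have "real (M []) \<le> real (length h * (2 * l))"
      by (simp only: of_nat_le_iff)
    then have "real (M []) \<le> real (length h) * (2 * real l)"
      by simp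
    moreover have "R * (2 * real l) \<le> real (M [])" using R by (simp add: M_def)
    ultimately have "R * (2 * real l) \<le> real (length h) * (2 * real l)" by linarith
    then show False using h l by (auto simp: mult_le_cancel_right)
  qed
qed

subsection \<open>Random token distributions\<close>

text \<open>Disjoint blocks of coordinates are independent. The induction splits the product measure
  into the coordinates in \<open>B j\<close> and the remaining ones.\<close>

lemma prob_Pi_pmf_no_full_block:
  fixes B :: "'i \<Rightarrow> 'a set"
  assumes "finite J" and p: "0 \<le> p" "p \<le> 1" and "finite A"
    and "disjoint_family_on B J" and "\<And>j. j \<in> J \<Longrightarrow> B j \<subseteq> A" and "\<And>j. j \<in> J \<Longrightarrow> card (B j) = m"
  shows "measure_pmf.prob (Pi_pmf A False (\<lambda>_. bernoulli_pmf p)) {f. \<forall>j\<in>J. \<exists>x\<in>B j. \<not> f x}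
         = (1 - p ^ m) ^ card J"
  using assms(1,4-)
proof (induction J arbitrary: A rule: finite_induct)
  case (insert j J)
  let ?P = "\<lambda>A. Pi_pmf A False (\<lambda>_. bernoulli_pmf p)"
  let ?E = "{f. \<exists>x\<in>B j. \<not> f x}" and ?E' = "{f. \<forall>j\<in>J. \<exists>x\<in>B j. \<not> f x}"
  have Bj: "B j \<subseteq> A" "finite (B j)" "card (B j) = m"
    using insert.prems finite_subset[OF _ \<open>finite A\<close>] by auto
  have disj: "B j \<inter> B i = {}" if "i \<in> J" for i
    using insert.prems(2) insert.hyps(2) that by (auto simp: disjoint_family_on_def)
  have E: "measure_pmf.prob (?P (B j)) ?E = 1 - p ^ m"
  proof -
    have "measure_pmf.prob (?P (B j)) {f. \<forall>x\<in>B j. f x} =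
        (\<Prod>x\<in>B j. measure_pmf.prob (bernoulli_pmf p) {True})"
      using measure_Pi_pmf_Pi[OF Bj(2), of False "\<lambda>_. bernoulli_pmf p" "\<lambda>_. {True}"]
      by (simp add: Pi_def Ball_def)
    also have "\<dots> = p ^ m"
      using p Bj by (simp add: measure_pmf_single)
    also have "{f. \<forall>x\<in>B j. f x} = - ?E" by auto
    finally show ?thesis
      using measure_pmf.prob_compl[of ?E "?P (B j)"] by (simp add: Compl_eq_Diff_UNIV)
  qed
  have E': "measure_pmf.prob (?P (A - B j)) ?E' = (1 - p ^ m) ^ card J"
  proof (rule insert.IH)
    show "disjoint_family_on B J"
      using insert.prems(2) by (rule disjoint_family_on_mono[rotated]) auto
    show "B i \<subseteq> A - B j" if "i \<in> J" for i
      using disj[OF that] insert.prems(3)[of i] that by auto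
  qed (use insert.prems in auto)
  let ?Q = "pair_pmf (?P (B j)) (?P (A - B j))"
  have "?P A = map_pmf (\<lambda>(f, g) x. if x \<in> B j then f x else g x) ?Q"
    using Pi_pmf_union[of "B j" "A - B j" False "\<lambda>_. bernoulli_pmf p"] Bj insert.prems(1)
    by (simp add: Un_absorb1)
  then have "measure_pmf.prob (?P A) {f. \<forall>j\<in>insert j J. \<exists>x\<in>B j. \<not> f x} =
      measure_pmf.prob ?Q ((\<lambda>(f, g) x. if x \<in> B j then f x else g x) -`
        {f. \<forall>j\<in>insert j J. \<exists>x\<in>B j. \<not> f x})"
    by simp
  also have "(\<lambda>(f, g) x. if x \<in> B j then f x else g x) -`
      {f. \<forall>j\<in>insert j J. \<exists>x\<in>B j. \<not> f x} = ?E \<times> ?E'"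
  proof -
    have "(\<exists>x\<in>B i. \<not> (if x \<in> B j then f x else g x)) \<longleftrightarrow> (\<exists>x\<in>B i. \<not> g x)"
      if "i \<in> J" for i f g
      using disj[OF that] by (intro bex_cong) auto
    then show ?thesis
      by (simp add: set_eq_iff cong: bex_cong ball_cong)
  qed
  \<comment> \<open>The product rule is applied to countable sets, so both events are cut down to
    the supports first.\<close>
  also have "measure_pmf.prob ?Q (?E \<times> ?E') =
      measure_pmf.prob ?Q ((?E \<inter> set_pmf (?P (B j))) \<times> (?E' \<inter> set_pmf (?P (A - B j))))"
    by (subst measure_Int_set_pmf[symmetric], rule arg_cong[where f = "measure_pmf.prob ?Q"]) auto
  also have "\<dots> = measure_pmf.prob (?P (B j)) ?E * measure_pmf.prob (?P (A - B j)) ?E'"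
    by (subst measure_pmf_prob_product) (auto simp: measure_Int_set_pmf intro: countable_Int2)
  also have "\<dots> = (1 - p ^ m) ^ card (insert j J)"
    using E E' insert.hyps by simp
  finally show ?case .
qed simp

text \<open>This is Hoeffding's inequality: at most one eighth of false coordinates means that the
  number of true ones exceeds its mean \<open>card X * (3/4)\<close> by at least
  \<open>card X / 8\<close>.\<close>

lemma prob_Pi_pmf_many_true:
  assumes "finite A" "X \<subseteq> A" "X \<noteq> {}"
  shows "measure_pmf.prob (Pi_pmf A False (\<lambda>_. bernoulli_pmf (3/4)))
           {f. real (card {x\<in>X. \<not> f x}) \<le> real (card X) / 8} \<le> exp (- real (card X) / 32)"
proof -
  have X: "finite X" "card X > 0"
    using assms finite_subset by (auto simp: card_gt_0_iff)
  let ?S = "{m. real m \<ge> real (card X) * (3/4) + real (card X) / 8}"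
  have "measure_pmf.prob (Pi_pmf A False (\<lambda>_. bernoulli_pmf (3/4)))
      {f. real (card {x\<in>X. \<not> f x}) \<le> real (card X) / 8} =
    measure_pmf.prob (Pi_pmf A False (\<lambda>_. bernoulli_pmf (3/4))) {f. card {x\<in>X. f x} \<in> ?S}"
  proof (intro arg_cong[where f = "measure_pmf.prob _"] Collect_cong)
    fix f :: "'a \<Rightarrow> bool"
    have "card X = card ({x\<in>X. f x} \<union> {x\<in>X. \<not> f x})"
      by (rule arg_cong[where f = card]) auto
    also have "\<dots> = card {x\<in>X. f x} + card {x\<in>X. \<not> f x}"
      using X by (intro card_Un_disjoint) auto
    finally show "(real (card {x\<in>X. \<not> f x}) \<le> real (card X) / 8) = (card {x\<in>X. f x} \<in> ?S)"
      by (auto simp: field_simps)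
  qed
  \<comment> \<open>The event ignores the coordinates outside \<open>X\<close>; resetting them to
    \<open>False\<close> leaves the product measure on \<open>X\<close>, whose count is
    binomial.\<close>
  also have "\<dots> = measure_pmf.prob
      (map_pmf (\<lambda>f x. if x \<in> X then f x else False) (Pi_pmf A False (\<lambda>_. bernoulli_pmf (3/4))))
      {f. card {x\<in>X. f x} \<in> ?S}"
    by (simp add: vimage_def cong: conj_cong)
  also have "\<dots> = measure_pmf.prob (Pi_pmf X False (\<lambda>_. bernoulli_pmf (3/4))) {f. card {x\<in>X. f x} \<in> ?S}"
    using Pi_pmf_subset[OF assms(1,2), of False "\<lambda>_. bernoulli_pmf (3/4)"] by simp
  also have "\<dots> = measure_pmf.prob (binomial_pmf (card X) (3/4)) ?S"
    by (subst binomial_pmf_altdef'[OF X(1) refl]) (auto simp: vimage_def)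
  also have "\<dots> \<le> exp (- 2 * (real (card X) / 8)\<^sup>2 / real (card X))"
    by (rule binomial_distribution.prob_ge) (use X in \<open>auto simp: binomial_distribution_def\<close>)
  also have "- 2 * (real (card X) / 8)\<^sup>2 / real (card X) = - real (card X) / 32"
    using X by (simp add: power2_eq_square field_simps)
  finally show ?thesis .
qed

text \<open>
  The positions \<open>(fst x, snd y)\<close>, \<open>(fst y, snd x)\<close> of different unordered pairs \<open>{x, y}\<close> are
  disjoint because \<open>fst\<close> and \<open>snd\<close> are injective on \<open>C\<close>; hence the events are independent.
\<close>

lemma prob_half_empty:
  assumes C: "C \<subseteq> {..<n} \<times> {..<k}" "inj_on fst C" "inj_on snd C"
  shows "measure_pmf.prob (random_distribution n k (3/4))
           {K. \<forall>x\<in>C. \<forall>y\<in>C. x \<noteq> y \<longrightarrow> \<not> (snd x \<in> K (fst y) \<and> snd y \<in> K (fst x))}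
         \<le> (7/16) ^ (card C choose 2)"
proof -
  let ?P = "Pi_pmf ({..<n} \<times> {..<k}) False (\<lambda>_. bernoulli_pmf (3/4))"
  define J where "J = {e. e \<subseteq> C \<and> card e = 2}"
  define B where "B e = {(fst x, snd y) |x y. x \<in> e \<and> y \<in> e \<and> x \<noteq> y}" for e :: "(nat \<times> nat) set"
  have finC: "finite C" using C(1) by (rule finite_subset) simp
  have pair: "\<exists>x y. x \<in> C \<and> y \<in> C \<and> x \<noteq> y \<and> e = {x, y} \<and> B e = {(fst x, snd y), (fst y, snd x)}"
    if e_J: "e \<in> J" for e
  proof -
    obtain x y where e: "e = {x, y}" "x \<noteq> y"
      using e_J unfolding J_def card_2_iff by blast
    then have "B e = {(fst x, snd y), (fst y, snd x)}"
      unfolding B_def by blast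
    then show ?thesis
      using e_J e unfolding J_def by blast
  qed
  have card_B: "card (B e) = 2" if "e \<in> J" for e
    using pair[OF that] C(2) by (auto simp: inj_on_def)
  have sub_B: "B e \<subseteq> {..<n} \<times> {..<k}" if "e \<in> J" for e
    using pair[OF that] C(1) by auto
  have disj: "disjoint_family_on B J"
    unfolding disjoint_family_on_def
  proof (intro ballI impI)
    fix e e' assume e: "e \<in> J" "e' \<in> J" "e \<noteq> e'"
    show "B e \<inter> B e' = {}"
    proof (rule ccontr)
      assume "B e \<inter> B e' \<noteq> {}"
      then obtain z where z: "z \<in> B e" "z \<in> B e'" by blast
      obtain x y where xy: "z = (fst x, snd y)" "x \<in> e" "y \<in> e" "x \<noteq> y"
        using z(1) unfolding B_def by blast
      obtain x' y' where xy': "z = (fst x', snd y')" "x' \<in> e'" "y' \<in> e'" "x' \<noteq> y'"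
        using z(2) unfolding B_def by blast
      have "x \<in> C" "y \<in> C" "x' \<in> C" "y' \<in> C"
        using xy xy' e unfolding J_def by auto
      then have "x = x'" "y = y'"
        using xy(1) xy'(1) inj_onD[OF C(2), of x x'] inj_onD[OF C(3), of y y'] by auto
      then have "e = {x, y}" "e' = {x, y}"
        using xy xy' pair[OF e(1)] pair[OF e(2)] by auto
      then show False
        using e(3) by simp
    qed
  qed
  have finJ: "finite J" using finC by (simp add: J_def)
  have "measure_pmf.prob (random_distribution n k (3/4))
      {K. \<forall>x\<in>C. \<forall>y\<in>C. x \<noteq> y \<longrightarrow> \<not> (snd x \<in> K (fst y) \<and> snd y \<in> K (fst x))} =
      measure_pmf.prob ?P {f. \<forall>x\<in>C. \<forall>y\<in>C. x \<noteq> y \<longrightarrow> \<not> (f (fst y, snd x) \<and> f (fst x, snd y))}"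
    by (simp add: random_distribution_def vimage_def)
  also have "\<dots> \<le> measure_pmf.prob ?P {f. \<forall>e\<in>J. \<exists>z\<in>B e. \<not> f z}"
  proof (rule measure_pmf.finite_measure_mono)
    show "{f. \<forall>x\<in>C. \<forall>y\<in>C. x \<noteq> y \<longrightarrow> \<not> (f (fst y, snd x) \<and> f (fst x, snd y))}
        \<subseteq> {f. \<forall>e\<in>J. \<exists>z\<in>B e. \<not> f z}"
    proof (rule subsetI, rule CollectI, rule ballI)
      fix f e
      assume f: "f \<in> {f. \<forall>x\<in>C. \<forall>y\<in>C. x \<noteq> y \<longrightarrow> \<not> (f (fst y, snd x) \<and> f (fst x, snd y))}"
        and e: "e \<in> J"
      obtain x y where xy: "x \<in> C" "y \<in> C" "x \<noteq> y" "B e = {(fst x, snd y), (fst y, snd x)}"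
        using pair[OF e] by metis
      then have "\<not> (f (fst y, snd x) \<and> f (fst x, snd y))"
        using f by simp
      then show "\<exists>z\<in>B e. \<not> f z"
        using xy(4) by auto
    qed
  qed simp
  \<comment> \<open>Each block has two positions, both true with probability 9/16.\<close>
  also have "\<dots> = (1 - (3/4) ^ 2) ^ card J"
    by (rule prob_Pi_pmf_no_full_block) (use finJ disj sub_B card_B in auto)
  also have "card J = card C choose 2"
    unfolding J_def by (rule n_subsets[OF finC])
  finally show ?thesis by (simp add: power2_eq_square)
qed

text \<open>Union bound: there are at most \<open>n ^ (2 * l)\<close> candidate configurations, each
  half-empty with probability at most \<open>exp (- l * (l - 1) / 4)\<close>. The constant 12 makes
  the total exponent at most \<open>l * (2 * ln n - 3 * ln n)\<close>, which is at most
  \<open>- ln n\<close>.\<close>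

lemma prob_not_half_empty_free:
  assumes n: "n > 0" and k: "k \<le> n" and l: "l > 0" "real l - 1 \<ge> 12 * ln (real n)"
  shows "measure_pmf.prob (random_distribution n k (3/4)) {K. \<not> half_empty_free n {..<k} l K}
         \<le> 1 / real n"
proof -
  let ?P = "random_distribution n k (3/4)"
  define \<C> where "\<C> = {C. C \<subseteq> {..<n} \<times> {..<k} \<and> card C = l \<and> inj_on fst C \<and> inj_on snd C}"
  define E where "E C = {K :: holdings. \<forall>x\<in>C. \<forall>y\<in>C. x \<noteq> y \<longrightarrow> \<not> (snd x \<in> K (fst y) \<and> snd y \<in> K (fst x))}"
    for C :: "(nat \<times> nat) set"
  have fin: "finite \<C>"
    by (rule finite_subset[of _ "Pow ({..<n} \<times> {..<k})"]) (auto simp: \<C>_def)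
  have "card \<C> \<le> card {C. C \<subseteq> {..<n} \<times> {..<k} \<and> card C = l}"
    by (rule card_mono) (auto simp: \<C>_def intro: finite_subset[of _ "Pow ({..<n} \<times> {..<k})"])
  also have "\<dots> = (n * k) choose l"
    by (subst n_subsets) auto
  also have "\<dots> \<le> (n * k) ^ l"
    by (cases "l \<le> n * k") (auto simp: binomial_le_pow binomial_eq_0)
  also have "\<dots> \<le> (n ^ 2) ^ l"
    using k by (intro power_mono) (auto simp: power2_eq_square)
  finally have card_C: "real (card \<C>) \<le> real n ^ (2 * l)"
    by (metis of_nat_le_iff of_nat_power power_mult)
  \<comment> \<open>Follows from e \<le> 3 < (16/7)^2.\<close>
  have exp_bound: "(7/16 :: real) \<le> exp (- (1/2))"
  proof -
    have "exp (1/2 :: real) ^ 2 = exp 1" by (simp add: exp_of_nat_mult[symmetric])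
    also have "\<dots> \<le> (16/7)\<^sup>2" using exp_le by (simp add: power2_eq_square)
    finally have "exp (1/2 :: real) \<le> 16/7" by (rule power2_le_imp_le) simp
    then show ?thesis by (simp add: exp_minus field_simps)
  qed
  have choose2: "real (l choose 2) = real l * (real l - 1) / 2"
    using l(1) by (cases l) (auto simp: choose_two real_of_nat_div algebra_simps)
  have "measure_pmf.prob ?P {K. \<not> half_empty_free n {..<k} l K} \<le> measure_pmf.prob ?P (\<Union>C\<in>\<C>. E C)"
    by (rule measure_pmf.finite_measure_mono) (auto simp: half_empty_free_def \<C>_def E_def)
  also have "\<dots> \<le> (\<Sum>C\<in>\<C>. measure_pmf.prob ?P (E C))"
    by (rule measure_pmf.finite_measure_subadditive_finite[OF fin]) simp
  also have "\<dots> \<le> (\<Sum>C\<in>\<C>. (7/16) ^ (l choose 2))"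
    unfolding E_def by (rule sum_mono) (use prob_half_empty in \<open>auto simp: \<C>_def\<close>)
  also have "\<dots> \<le> real n ^ (2 * l) * exp (- (1/2)) ^ (l choose 2)"
    using card_C exp_bound by (simp add: mult_mono power_mono)
  also have "\<dots> = exp (real (2 * l) * ln (real n)) * exp (real (l choose 2) * (- (1/2)))"
    using n by (simp only: exp_of_nat_mult) simp
  also have "\<dots> = exp (real l * (2 * ln (real n) - (real l - 1) / 4))"
    by (simp add: choose2 mult_exp_exp field_simps)
  also have "\<dots> \<le> exp (1 * (- ln (real n)))"
  proof (subst exp_le_cancel_iff)
    have "real l * (2 * ln (real n) - (real l - 1) / 4) \<le> real l * (- ln (real n))"
      using l by (intro mult_left_mono) auto
    also have "\<dots> \<le> 1 * (- ln (real n))"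
      using l n by (intro mult_right_mono_neg) auto
    finally show "real l * (2 * ln (real n) - (real l - 1) / 4) \<le> 1 * (- ln (real n))" .
  qed
  also have "\<dots> = 1 / real n"
    using n by (simp add: exp_minus inverse_eq_divide)
  finally show ?thesis .
qed

text \<open>Concentration over the \<open>n * card T\<close> positions. The exponent is weakened to
  that of a single token, so the same bound serves all \<open>T\<close>.\<close>

lemma prob_few_missing:
  assumes n: "n > 0" and T: "T \<subseteq> {..<k}" "T \<noteq> {}"
  shows "measure_pmf.prob (random_distribution n k (3/4))
           {K. real (card (missing n T K)) \<le> real (n * card T) / 8} \<le> exp (- real n / 32)"
proof -
  let ?P = "Pi_pmf ({..<n} \<times> {..<k}) False (\<lambda>_. bernoulli_pmf (3/4))"
  let ?X = "{..<n} \<times> T"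
  have "finite T" using T(1) by (rule finite_subset) simp
  have "missing n T (\<lambda>v. {i. f (v, i)}) = {x\<in>?X. \<not> f x}" for f
    by (auto simp: missing_def)
  then have "measure_pmf.prob (random_distribution n k (3/4))
      {K. real (card (missing n T K)) \<le> real (n * card T) / 8} =
    measure_pmf.prob ?P {f. real (card {x\<in>?X. \<not> f x}) \<le> real (card ?X) / 8}"
    by (simp add: random_distribution_def vimage_def card_cartesian_product)
  also have "\<dots> \<le> exp (- real (card ?X) / 32)"
    by (rule prob_Pi_pmf_many_true) (use n T in auto)
  also have "\<dots> \<le> exp (- real n / 32)"
    using \<open>finite T\<close> T(2) by (simp add: mult_le_cancel_left1 card_gt_0_iff Suc_le_eq)
  finally show ?thesis .
qed

subsection \<open>The lower bound\<close>

text \<open>The smallest positive \<open>l\<close> with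
  \<open>real l - 1 \<ge> 12 * ln (real n)\<close>, as the union bound requires.\<close>

definition config_size :: "nat \<Rightarrow> nat" where
  "config_size n = nat \<lceil>12 * ln (real n)\<rceil> + 1"

text \<open>Up to a factor 2 only the larger summand matters. If \<open>ln n \<le> k\<close>, it is
  \<open>n * k / ln n\<close>, obtained by counting all tokens; otherwise it is \<open>n\<close>,
  obtained by counting token 0 alone.\<close>

lemma every_algorithm_needs_rounds_lower_bound:
  assumes k: "1 \<le> k" and ln: "ln (real n) \<ge> 1"
    and free: "half_empty_free n {..<k} (config_size n) K'"
    and all: "real (n * k) / 16 \<le> real (card (missing n {..<k} (\<lambda>v. I v \<union> K' v)))"
    and one: "real n / 8 \<le> real (card (missing n {0} I))"
  shows "every_algorithm_needs_rounds n k I (1/1000 * (real n * real k / ln (real n) + real n))"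
proof (cases "ln (real n) \<le> real k")
  case True
  have n: "n > 0" using ln by (cases n) auto
  show ?thesis
  proof (rule every_algorithm_needs_rounds_missing[OF n order.refl free])
    have "real n \<le> real n * real k / ln (real n)"
      using mult_left_mono[OF True, of "real n"] ln by (simp add: field_simps)
    then have sum_le: "real n * real k / ln (real n) + real n \<le> 2 * (real n * real k / ln (real n))"
      unfolding mult_2 by (rule add_left_mono)
    \<comment> \<open>Rounding and the added 1 cost at most 2, hence at most
      \<open>2 * ln n\<close>.\<close>
    have size_le: "real (config_size n) \<le> 14 * ln (real n)"
      using ln unfolding config_size_def by linarith
    have "(1/1000 * (real n * real k / ln (real n) + real n)) * (2 * real (config_size n))
        \<le> (1/1000 * (2 * (real n * real k / ln (real n)))) * (2 * (14 * ln (real n)))"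
      by (intro mult_mono sum_le size_le) (use ln in auto)
    \<comment> \<open>The logarithms cancel, leaving the factor 56/1000 < 1/16.\<close>
    also have "\<dots> \<le> real (n * k) / 16"
      using ln by (simp add: field_simps)
    also note all
    finally show "(1/1000 * (real n * real k / ln (real n) + real n)) * (2 * real (config_size n))
        \<le> real (card (missing n {..<k} (\<lambda>v. I v \<union> K' v)))" .
  qed
next
  case False
  have n: "n > 0" using ln by (cases n) auto
  \<comment> \<open>With one token there are no two pairs with distinct tokens, so size 2 is
    excluded even without auxiliary sets.\<close>
  have free2: "half_empty_free n {0} 2 (\<lambda>_. {})"
    unfolding half_empty_free_def
  proof (intro allI impI)
    fix C assume C: "C \<subseteq> {..<n} \<times> {0} \<and> card C = 2 \<and> inj_on fst C \<and> inj_on snd C"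
    then have "snd ` C \<subseteq> {0}" by auto
    from card_mono[OF _ this] have "card (snd ` C) \<le> 1" by simp
    then show "\<exists>x\<in>C. \<exists>y\<in>C. x \<noteq> y \<and> snd x \<in> {} \<and> snd y \<in> {}"
      using C by (auto simp: card_image)
  qed
  show ?thesis
  proof (rule every_algorithm_needs_rounds_missing[OF n _ free2])
    have "real n * real k / ln (real n) \<le> real n"
      using mult_left_mono[of "real k" "ln (real n)" "real n"] False ln by (simp add: field_simps)
    then have "(1/1000 * (real n * real k / ln (real n) + real n)) * (2 * real 2) \<le> real n / 8"
      by simp
    then show "(1/1000 * (real n * real k / ln (real n) + real n)) * (2 * real 2)
        \<le> real (card (missing n {0} (\<lambda>v. I v \<union> {})))"
      using one by simp
  qed (use k in auto)
qed

section \<open>Combining the random events\<close>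

definition bad_holdings :: "nat \<Rightarrow> nat \<Rightarrow> holdings set" where
  "bad_holdings n k = {K. \<not> half_empty_free n {..<k} (config_size n) K} \<union>
     {K. real (card (missing n {..<k} K)) \<le> real (n * k) / 8} \<union>
     {K. real (card (missing n {0} K)) \<le> real n / 8}"

lemma prob_bad_holdings:
  assumes "n > 0" "1 \<le> k" "k \<le> n"
  shows "measure_pmf.prob (random_distribution n k (3/4)) (bad_holdings n k)
         \<le> 1 / real n + 2 * exp (- real n / 32)"
proof -
  let ?P = "measure_pmf.prob (random_distribution n k (3/4))"
  have "?P (bad_holdings n k) \<le> ?P {K. \<not> half_empty_free n {..<k} (config_size n) K} +
      ?P {K. real (card (missing n {..<k} K)) \<le> real (n * k) / 8} +
      ?P {K. real (card (missing n {0} K)) \<le> real n / 8}"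
    unfolding bad_holdings_def
    by (intro order.trans[OF measure_Un_le] add_mono) auto
  also have "\<dots> \<le> 1 / real n + exp (- real n / 32) + exp (- real n / 32)"
  proof (intro add_mono)
    show "?P {K. \<not> half_empty_free n {..<k} (config_size n) K} \<le> 1 / real n"
      by (rule prob_not_half_empty_free)
        (use assms in \<open>auto simp: config_size_def\<close>)
    show "?P {K. real (card (missing n {..<k} K)) \<le> real (n * k) / 8} \<le> exp (- real n / 32)"
      using prob_few_missing[of n "{..<k}" k] assms by (simp add: lessThan_empty_iff)
    show "?P {K. real (card (missing n {0} K)) \<le> real n / 8} \<le> exp (- real n / 32)"
      using prob_few_missing[of n "{0}" k] assms by simp
  qed
  finally show ?thesis by simp
qed

text \<open>Each token has a unique holder \<open>f i\<close>, so the initial distribution fills at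
  most the one pair \<open>(f i, i)\<close> per token.\<close>

lemma card_missing_single_holder:
  assumes I: "single_holder n k I"
  shows "card (missing n {..<k} K') \<le> card (missing n {..<k} (\<lambda>v. I v \<union> K' v)) + k"
    and "k > 0 \<Longrightarrow> n \<le> card (missing n {0} I) + 1"
proof -
  obtain f where f: "\<And>v i. i < k \<Longrightarrow> v < n \<Longrightarrow> i \<in> I v \<Longrightarrow> v = f i"
    using I unfolding single_holder_def by metis
  have "card (missing n {..<k} K') \<le>
      card (missing n {..<k} (\<lambda>v. I v \<union> K' v) \<union> (\<lambda>i. (f i, i)) ` {..<k})"
    by (intro card_mono finite_UnI finite_missing) (use f in \<open>auto simp: missing_def\<close>)
  also have "\<dots> \<le> card (missing n {..<k} (\<lambda>v. I v \<union> K' v)) + card ((\<lambda>i. (f i, i)) ` {..<k})"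
    by (rule card_Un_le)
  also have "card ((\<lambda>i. (f i, i)) ` {..<k}) \<le> k"
    using card_image_le[of "{..<k}" "\<lambda>i. (f i, i)"] by simp
  finally show "card (missing n {..<k} K') \<le> card (missing n {..<k} (\<lambda>v. I v \<union> K' v)) + k"
    by simp
  assume "k > 0"
  then have "{..<n} \<times> {0} \<subseteq> missing n {0} I \<union> {(f 0, 0)}"
    using f by (auto simp: missing_def)
  then have "card ({..<n} \<times> {0 :: nat}) \<le> card (missing n {0} I \<union> {(f 0, 0)})"
    by (rule card_mono[rotated]) (simp add: finite_missing)
  also have "\<dots> \<le> card (missing n {0} I) + card {(f 0, 0 :: nat)}"
    by (rule card_Un_le)
  finally show "n \<le> card (missing n {0} I) + 1"
    by simp
qed

theorem theorem1:
  shows "\<exists>c>0. \<exists>a>0. \<exists>N::nat. \<forall>n\<ge>N. \<forall>k::nat. 1 \<le> k \<and> k \<le> n \<longrightarrow>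
    (\<forall>I. single_holder n k I \<longrightarrow>
       every_algorithm_needs_rounds n k I (c * (real n * real k / ln (real n) + real n))) \<and>
    measure_pmf.prob (random_distribution n k (3/4))
       {I. every_algorithm_needs_rounds n k I (c * (real n * real k / ln (real n) + real n))}
     \<ge> 1 - real n powr (- a)"
proof -
  \<comment> \<open>From 16 on, \<open>n * k / 8 - k\<close> is at least \<open>n * k / 16\<close>.
    The third condition gives the probability in (b) with \<open>a = 1/2\<close>; the last one gives
    existence in (a).\<close>
  have "eventually (\<lambda>n::nat. ln (real n) \<ge> 1 \<and> n \<ge> 16 \<and>
      1 / real n + 2 * exp (- real n / 32) \<le> real n powr (- (1/2)) \<and>
      1 / real n + 2 * exp (- real n / 32) < 1) at_top"
    by (intro eventually_conj; (rule eventually_ge_at_top)?; real_asymp)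
  then obtain N where N: "\<And>n::nat. n \<ge> N \<Longrightarrow> ln (real n) \<ge> 1" "\<And>n. n \<ge> N \<Longrightarrow> n \<ge> 16"
    "\<And>n::nat. n \<ge> N \<Longrightarrow> 1 / real n + 2 * exp (- real n / 32) \<le> real n powr (- (1/2))"
    "\<And>n::nat. n \<ge> N \<Longrightarrow> 1 / real n + 2 * exp (- real n / 32) < 1"
    unfolding eventually_at_top_linorder by blast
  show ?thesis
  proof (rule exI[of _ "1/1000"], rule conjI, simp, rule exI[of _ "1/2"], rule conjI, simp,
      rule exI[of _ N], intro allI impI, elim conjE, intro conjI allI impI)
    fix n k :: nat
    assume n: "n \<ge> N" and k: "1 \<le> k" "k \<le> n"
    let ?p = "random_distribution n k (3/4)"
    let ?good = "\<lambda>I. every_algorithm_needs_rounds n k I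
      (1/1000 * (real n * real k / ln (real n) + real n))"
    have bad: "measure_pmf.prob ?p (bad_holdings n k) \<le> 1 / real n + 2 * exp (- real n / 32)"
      using N(2)[OF n] k by (intro prob_bad_holdings) auto
    show "?good I" if I: "single_holder n k I" for I
    proof -
      \<comment> \<open>Probabilistic method: bad holdings have probability below 1, so some
        \<open>K'\<close> is not bad.\<close>
      have "measure_pmf.prob ?p (bad_holdings n k) \<noteq> measure_pmf.prob ?p UNIV"
        using bad N(4)[OF n] by simp
      then obtain K' where K': "K' \<notin> bad_holdings n k"
        by (metis UNIV_eq_I)
      show ?thesis
      proof (rule every_algorithm_needs_rounds_lower_bound[OF k(1) N(1)[OF n]])
        show "half_empty_free n {..<k} (config_size n) K'"
          using K' by (simp add: bad_holdings_def)
        have "real (n * k) / 8 \<le> real (card (missing n {..<k} K'))"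
          using K' by (simp add: bad_holdings_def)
        also have "\<dots> \<le> real (card (missing n {..<k} (\<lambda>v. I v \<union> K' v))) + real k"
          using card_missing_single_holder(1)[OF I, of K'] by linarith
        finally have "real (n * k) / 8 - real k \<le> real (card (missing n {..<k} (\<lambda>v. I v \<union> K' v)))"
          by simp
        moreover have "16 * real k \<le> real (n * k)"
          using N(2)[OF n] by (simp add: mult_right_mono)
        ultimately show "real (n * k) / 16 \<le> real (card (missing n {..<k} (\<lambda>v. I v \<union> K' v)))"
          by linarith
        show "real n / 8 \<le> real (card (missing n {0} I))"
          using card_missing_single_holder(2)[OF I] k N(2)[OF n] by linarith
      qed
    qed
    have "1 - real n powr (- (1/2)) \<le> 1 - measure_pmf.prob ?p (bad_holdings n k)"
      using bad N(3)[OF n] by linarith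
    also have "\<dots> = measure_pmf.prob ?p (- bad_holdings n k)"
      using measure_pmf.prob_compl[of "bad_holdings n k" ?p] by (simp add: Compl_eq_Diff_UNIV)
    also have "\<dots> \<le> measure_pmf.prob ?p {I. ?good I}"
    proof (rule measure_pmf.finite_measure_mono)
      show "- bad_holdings n k \<subseteq> {I. ?good I}"
      proof (rule subsetI, rule CollectI)
        fix I assume I: "I \<in> - bad_holdings n k"
        \<comment> \<open>Here \<open>K'\<close> is \<open>I\<close> itself, so
          \<open>I v \<union> K' v\<close> is just \<open>I v\<close>.\<close>
        have "real (n * k) / 16 \<le> real (n * k) / 8" by simp
        then show "?good I"
          using I by (intro every_algorithm_needs_rounds_lower_bound[OF k(1) N(1)[OF n], of I])
            (auto simp: bad_holdings_def)
      qed
    qed simp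
    finally show "1 - real n powr (- (1/2)) \<le> measure_pmf.prob ?p {I. ?good I}" .
  qed
qed

end
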